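(* The measure $M$ is imperfect in its detection range; it vanishes for some states having no product eigenbasis, including some inseparable states. Specifically: (1) The two-qubit state $\sigma=\frac16\left(|00\rangle\langle00|+2|01\rangle\langle01|+3|1+\rangle\langle1+|\right)$, where $|+\rangle=(|0\rangle+|1\rangle)/\sqrt2$, satisfies $M(\sigma)=0$ but has no product eigenbasis. (2) The state $\tau=\frac13\left(|\phi\rangle\langle\phi|+|\psi\rangle\langle\psi|+|\xi\rangle\langle\xi|\right)$ on $\mathbb C^3\otimes\mathbb C^3$, where $|\phi\rangle=(|0\rangle|1\rangle+|1\rangle|0\rangle)/\sqrt2$, $|\psi\rangle=(|1\rangle|2\rangle+|2\rangle|1\rangle)/\sqrt2$, $|\xi\rangle=(|2\rangle|0\rangle+|0\rangle|2\rangle)/\sqrt2$, satisfies $M(\tau)=0$ but is inseparable.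
   Context: A density matrix is a positive semidefinite Hermitian matrix of trace one. A density matrix on $\mathcal H^{\rm A}\otimes\mathcal H^{\rm B}$ has a product eigenbasis if there are orthonormal bases $\{|v_j^{\rm A}\rangle\}$ of $\mathcal H^{\rm A}$ and $\{|v_k^{\rm B}\rangle\}$ of $\mathcal H^{\rm B}$ and real numbers $e_{jk}$ with $\rho^{\rm AB}=\sum_{j,k}e_{jk}|v_j^{\rm A}\rangle\langle v_j^{\rm A}|\otimes|v_k^{\rm B}\rangle\langle v_k^{\rm B}|$. It is separable if it is a convex combination of tensor products of density matrices on $\mathcal H^{\rm A}$ and $\mathcal H^{\rm B}$, and inseparable otherwise. In a ket such as $|1+\rangle=|1\rangle\otimes|+\rangle$ the first factor belongs to subsystem A and the second to B; $|0\rangle,|1\rangle$ (resp. $|0\rangle,|1\rangle,|2\rangle$) is the standard basis of $\mathbb C^2$ (resp. $\mathbb C^3$). Definition of $M$. For $x,y\ge0$ let ${\rm nim}_y(x)$ be the nearest integer multiple of $y$ to $x$, ties rounded down: ${\rm nim}_0(x)=0$, and for $y\neq0$, ${\rm nim}_y(x)=y\lfloor x/y\rfloor$ if $x-y\lfloor x/y\rfloor\le y\lceil x/y\rceil-x$, and ${\rm nim}_y(x)=y\lceil x/y\rceil$ otherwise. Let $\eta_1,\dots,\eta_m$ be the distinct eigenvalues of $\rho^{\rm AB}$, let $d^{\eta_j}$ be the dimension of the $\eta_j$-eigenspace, and let $\tilde\rho^{\eta_j}$ be $\eta_j$ times the orthogonal projector onto the $\eta_j$-eigenspace, so $\rho^{\rm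 AB}=\sum_j\tilde\rho^{\eta_j}$. Let $\lambda_i^{j,{\rm A}}$, $i=1,\dots,d_j^{\rm A}$, be the nonzero eigenvalues, with multiplicity, of ${\rm Tr}_{\rm B}\tilde\rho^{\eta_j}$, where $d_j^{\rm A}$ is its rank (an eigenvalue $\eta_j=0$ contributes an empty sum). Define $$M^{\rm A}(\rho^{\rm AB})=-\sum_{j=1}^m\sum_{i=1}^{d_j^{\rm A}}\left|\lambda_i^{j,{\rm A}}-{\rm nim}_{\eta_j}(\lambda_i^{j,{\rm A}})\right|\log_2\frac{\lambda_i^{j,{\rm A}}}{\eta_jd^{\eta_j}}.$$ $M^{\rm B}(\rho^{\rm AB})$ is defined in the same way using the nonzero eigenvalues $\lambda_i^{j,{\rm B}}$ of ${\rm Tr}_{\rm A}\tilde\rho^{\eta_j}$. Finally $M(\rho^{\rm AB})=\frac12[M^{\rm A}(\rho^{\rm AB})+M^{\rm B}(\rho^{\rm AB})]$. *)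

theory Defs
  imports "HOL-Analysis.Analysis"
begin

text \<open>The Hilbert spaces are \<open>complex^'a\<close> and \<open>complex^'b\<close> with
  standard bases indexed by \<open>'a\<close> and \<open>'b\<close>; their tensor product is
  \<open>complex^('a \<times> 'b)\<close>, in which the index \<open>(i, k)\<close> stands for the product of the
  \<open>i\<close>-th and the \<open>k\<close>-th standard basis vector.\<close>

definition cdot :: "complex^'n \<Rightarrow> complex^'n \<Rightarrow> complex" where
  "cdot v w = (\<Sum>i\<in>UNIV. cnj (v $ i) * w $ i)"

definition ket :: "'n \<Rightarrow> complex^'n" where
  "ket i = axis i 1"

definition ketbra :: "complex^'n \<Rightarrow> complex^'n \<Rightarrow> complex^'n^'n" where
  "ketbra v w = (\<chi> i j. v $ i * cnj (w $ j))"

definition vec_tensor :: "complex^'a \<Rightarrow> complex^'b \<Rightarrow> complex^('a::finite \<times> 'b::finite)" where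
  "vec_tensor v w = (\<chi> p. v $ fst p * w $ snd p)"

definition mat_tensor ::
    "complex^'a^'a \<Rightarrow> complex^'b^'b \<Rightarrow> complex^('a \<times> 'b)^('a \<times> 'b)" where
  "mat_tensor A B = (\<chi> p q. A $ fst p $ fst q * B $ snd p $ snd q)"

definition ptrace_B :: "complex^('a::finite \<times> 'b::finite)^('a::finite \<times> 'b::finite) \<Rightarrow> complex^'a^'a" where
  "ptrace_B R = (\<chi> i j. \<Sum>k\<in>UNIV. R $ (i, k) $ (j, k))"

definition ptrace_A :: "complex^('a::finite \<times> 'b::finite)^('a::finite \<times> 'b::finite) \<Rightarrow> complex^'b^'b" where
  "ptrace_A R = (\<chi> k l. \<Sum>i\<in>UNIV. R $ (i, k) $ (i, l))"

definition hermitian :: "complex^'n^'n \<Rightarrow> bool" where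
  "hermitian A \<longleftrightarrow> (\<forall>i j. A $ i $ j = cnj (A $ j $ i))"

definition density_matrix :: "complex^'n^'n \<Rightarrow> bool" where
  "density_matrix R \<longleftrightarrow>
     hermitian R \<and> (\<forall>v. 0 \<le> Re (cdot v (R *v v))) \<and> trace R = 1"

definition orthonormal_basis :: "('n \<Rightarrow> complex^'n) \<Rightarrow> bool" where
  "orthonormal_basis v \<longleftrightarrow>
     (\<forall>j k. cdot (v j) (v k) = (if j = k then 1 else 0)) \<and> vec.span (range v) = UNIV"

definition has_product_eigenbasis :: "complex^('a::finite \<times> 'b::finite)^('a::finite \<times> 'b::finite) \<Rightarrow> bool" where
  "has_product_eigenbasis R \<longleftrightarrow>
     (\<exists>(v :: 'a \<Rightarrow> complex^'a) (w :: 'b \<Rightarrow> complex^'b) (e :: 'a \<Rightarrow> 'b \<Rightarrow> real).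
        orthonormal_basis v \<and> orthonormal_basis w \<and>
        R = (\<Sum>j\<in>UNIV. \<Sum>k\<in>UNIV.
               e j k *\<^sub>R mat_tensor (ketbra (v j) (v j)) (ketbra (w k) (w k))))"

definition separable :: "complex^('a::finite \<times> 'b::finite)^('a::finite \<times> 'b::finite) \<Rightarrow> bool" where
  "separable R \<longleftrightarrow>
     (\<exists>(n::nat) (p :: nat \<Rightarrow> real) (A :: nat \<Rightarrow> complex^'a^'a) (B :: nat \<Rightarrow> complex^'b^'b).
        (\<forall>i<n. 0 \<le> p i \<and> density_matrix (A i) \<and> density_matrix (B i)) \<and>
        (\<Sum>i<n. p i) = 1 \<and>
        R = (\<Sum>i<n. p i *\<^sub>R mat_tensor (A i) (B i)))"

text \<open>Eigenvalues are taken in the reals: the notions below are only applied to Hermitian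
  matrices. For these, the multiplicity of an eigenvalue is the dimension of its eigenspace.\<close>

definition eigenspace :: "complex^'n^'n \<Rightarrow> real \<Rightarrow> (complex^'n) set" where
  "eigenspace A \<eta> = {v. A *v v = complex_of_real \<eta> *s v}"

definition eigenvalues :: "complex^'n^'n \<Rightarrow> real set" where
  "eigenvalues A = {\<eta>. \<exists>v\<in>eigenspace A \<eta>. v \<noteq> 0}"

definition multiplicity_of :: "complex^'n^'n \<Rightarrow> real \<Rightarrow> nat" where
  "multiplicity_of A \<eta> = vec.dim (eigenspace A \<eta>)"

definition orth_projector :: "(complex^'n) set \<Rightarrow> complex^'n^'n" where
  "orth_projector S = (THE P. hermitian P \<and> P ** P = P \<and> range (\<lambda>v. P *v v) = S)"

definition spectral_part :: "complex^'n^'n \<Rightarrow> real \<Rightarrow> complex^'n^'n" where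
  "spectral_part R \<eta> = \<eta> *\<^sub>R orth_projector (eigenspace R \<eta>)"

definition nim :: "real \<Rightarrow> real \<Rightarrow> real" where
  "nim y x =
     (if y = 0 then 0
      else if x - y * \<lfloor>x / y\<rfloor> \<le> y * \<lceil>x / y\<rceil> - x then y * \<lfloor>x / y\<rfloor>
      else y * \<lceil>x / y\<rceil>)"

text \<open>A sum over the nonzero eigenvalues with multiplicity is a sum over the distinct nonzero
  eigenvalues, each term weighted by the multiplicity.\<close>

definition M_A :: "complex^('a::finite \<times> 'b::finite)^('a::finite \<times> 'b::finite) \<Rightarrow> real" where
  "M_A R = - (\<Sum>\<eta>\<in>eigenvalues R.
     \<Sum>l\<in>eigenvalues (ptrace_B (spectral_part R \<eta>)) - {0}.
       real (multiplicity_of (ptrace_B (spectral_part R \<eta>)) l) *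
         (\<bar>l - nim \<eta> l\<bar> * log 2 (l / (\<eta> * real (multiplicity_of R \<eta>)))))"

definition M_B :: "complex^('a::finite \<times> 'b::finite)^('a::finite \<times> 'b::finite) \<Rightarrow> real" where
  "M_B R = - (\<Sum>\<eta>\<in>eigenvalues R.
     \<Sum>l\<in>eigenvalues (ptrace_A (spectral_part R \<eta>)) - {0}.
       real (multiplicity_of (ptrace_A (spectral_part R \<eta>)) l) *
         (\<bar>l - nim \<eta> l\<bar> * log 2 (l / (\<eta> * real (multiplicity_of R \<eta>)))))"

definition M :: "complex^('a::finite \<times> 'b::finite)^('a::finite \<times> 'b::finite) \<Rightarrow> real" where
  "M R = (M_A R + M_B R) / 2"

definition ket_plus :: "complex^2" where
  "ket_plus = (1 / sqrt 2) *\<^sub>R (ket 0 + ket 1)"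

definition \<sigma> :: "complex^(2 \<times> 2)^(2 \<times> 2)" where
  "\<sigma> = (let k00 = vec_tensor (ket 0) (ket 0);
             k01 = vec_tensor (ket 0) (ket 1);
             k1p = vec_tensor (ket 1) ket_plus
         in (1 / 6) *\<^sub>R (ketbra k00 k00 + 2 *\<^sub>R ketbra k01 k01 + 3 *\<^sub>R ketbra k1p k1p))"

text \<open>In the type \<open>3\<close> the numerals \<open>0\<close>, \<open>1\<close>, \<open>2\<close> are its three distinct elements.\<close>

definition sym_pair :: "3 \<Rightarrow> 3 \<Rightarrow> complex^(3 \<times> 3)" where
  "sym_pair i j =
     (1 / sqrt 2) *\<^sub>R (vec_tensor (ket i) (ket j) + vec_tensor (ket j) (ket i))"

definition \<tau> :: "complex^(3 \<times> 3)^(3 \<times> 3)" where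
  "\<tau> = (let \<phi> = sym_pair 0 1; \<psi> = sym_pair 1 2; \<xi> = sym_pair 2 0
         in (1 / 3) *\<^sub>R (ketbra \<phi> \<phi> + ketbra \<psi> \<psi> + ketbra \<xi> \<xi>))"

end

(* sigma and tau have the form sum_k c_k |u_k><u_k| with u_k orthonormal, so the spectral part at
   eta is eta times the sum of the |u_k><u_k| with c_k = eta. If the partial traces of these
   projectors are idempotent, every nonzero eigenvalue of the partial traces of the spectral part
   equals eta, and M = 0. This holds for sigma (pure product eigenvectors, distinct eigenvalues)
   and for tau (both partial traces of the projector are the identity).
   If rho has a product eigenbasis, its blocks <i|rho|j> on the second factor are all diagonal in
   the basis of that factor, hence commute; two blocks of sigma, and two of tau, do not.
   If rho is separable and <ik|rho|ik> = 0, then in each term of the mixture one of the factors has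
   a vanishing diagonal entry, hence by positivity a vanishing row, so <il|rho|jk> = 0.
   For tau, <00|tau|00> = 0 but <01|tau|10> = 1/6. *)
theory Submission
  imports Defs
begin

section \<open>Inner products, rank-one operators and Hermitian matrices\<close>

lemma cdot_sum_right: "cdot v (\<Sum>k\<in>K. f k) = (\<Sum>k\<in>K. cdot v (f k))"
  unfolding cdot_def by (simp add: sum_distrib_left) (rule sum.swap)

lemma cdot_scale_right: "cdot v (c *s w) = c * cdot v w"
  by (simp add: cdot_def sum_distrib_left mult_ac)

lemma cnj_cdot: "cnj (cdot v w) = cdot w v"
  by (simp add: cdot_def mult.commute)

lemma sum_matrix_vector_mult: "(\<Sum>k\<in>K. A k) *v v = (\<Sum>k\<in>K. A k *v v)"
  for A :: "_ \<Rightarrow> complex^'n^'m"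
  by (induction K rule: infinite_finite_induct) (auto simp: matrix_vector_mult_add_rdistrib)

lemma ketbra_mult_vec: "ketbra u v *v x = cdot v x *s u"
  by (simp add: vec_eq_iff ketbra_def cdot_def matrix_vector_mult_def sum_distrib_left
      sum_distrib_right mult_ac)

lemma scaleR_matrix_vector_mult: "(r *\<^sub>R A) *v v = complex_of_real r *s (A *v v)"
  for A :: "complex^'n^'m"
  by (simp add: vec_eq_iff matrix_vector_mult_def sum_distrib_left scaleR_conv_of_real[where 'a=complex] mult_ac)

lemma ketbra_mult: "ketbra u v ** ketbra x y = (\<chi> i j. cdot v x * ketbra u y $ i $ j)"
  by (simp add: vec_eq_iff ketbra_def cdot_def matrix_matrix_mult_def sum_distrib_left
      sum_distrib_right mult_ac)

lemma ketbra_idempotent: "cdot u u = 1 \<Longrightarrow> ketbra u u ** ketbra u u = ketbra u u"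
  by (simp add: ketbra_mult vec_eq_iff)

lemma hermitian_ketbra: "hermitian (ketbra u u)"
  by (simp add: hermitian_def ketbra_def)

lemma hermitian_scaleR:
  assumes "hermitian A"
  shows "hermitian (r *\<^sub>R A)"
  unfolding hermitian_def
proof (intro allI)
  fix i j
  have "A $ i $ j = cnj (A $ j $ i)" using assms unfolding hermitian_def by blast
  then show "(r *\<^sub>R A) $ i $ j = cnj ((r *\<^sub>R A) $ j $ i)"
    by (simp only: vector_scaleR_component complex_cnj_scaleR)
qed

lemma hermitian_sum:
  assumes "\<And>k. k \<in> K \<Longrightarrow> hermitian (A k)"
  shows "hermitian (\<Sum>k\<in>K. A k)"
  unfolding hermitian_def
proof (intro allI)
  fix i j
  have "(\<Sum>k\<in>K. A k $ i $ j) = (\<Sum>k\<in>K. cnj (A k $ j $ i))"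
    by (rule sum.cong[OF refl]) (use assms hermitian_def in blast)
  then show "(\<Sum>k\<in>K. A k) $ i $ j = cnj ((\<Sum>k\<in>K. A k) $ j $ i)"
    by (simp only: sum_component cnj_sum)
qed

section \<open>Uniqueness of the orthogonal projector onto a subspace\<close>

lemma hermitian_mult_swap:
  assumes "hermitian A" "hermitian B" "hermitian (A ** B)"
  shows "A ** B = B ** A"
proof -
  have "(A ** B) $ i $ j = (B ** A) $ i $ j" for i j
  proof -
    \<comment> \<open>\<open>A ** B\<close> is its own conjugate transpose, which is the product of
      the conjugate transposes in reverse order.\<close>
    have "(A ** B) $ i $ j = cnj ((A ** B) $ j $ i)"
      using assms(3) unfolding hermitian_def by blast
    also have "\<dots> = (\<Sum>k\<in>UNIV. cnj (A $ j $ k) * cnj (B $ k $ i))"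
      by (simp add: matrix_matrix_mult_def)
    also have "\<dots> = (\<Sum>k\<in>UNIV. B $ i $ k * A $ k $ j)"
    proof (rule sum.cong[OF refl])
      fix k
      have "cnj (A $ j $ k) = A $ k $ j" "cnj (B $ k $ i) = B $ i $ k"
        using assms(1,2) unfolding hermitian_def by metis+
      then show "cnj (A $ j $ k) * cnj (B $ k $ i) = B $ i $ k * A $ k $ j"
        by (simp add: mult.commute)
    qed
    finally show ?thesis by (simp add: matrix_matrix_mult_def)
  qed
  then show ?thesis by (simp add: vec_eq_iff)
qed

lemma idempotent_fixes_range:
  fixes P Q :: "complex^'n^'n"
  assumes "P ** P = P" "range ((*v) Q) \<subseteq> range ((*v) P)"
  shows "P ** Q = Q"
proof -
  have "(P ** Q) *v x = Q *v x" for x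
  proof -
    obtain y where "Q *v x = P *v y" using assms(2) by blast
    then show ?thesis
      by (metis assms(1) matrix_vector_mul_assoc)
  qed
  then show ?thesis by (simp add: matrix_eq)
qed

text \<open>Makes the description by \<open>THE\<close> usable. If \<open>P\<close> and
  \<open>Q\<close> both qualify, each fixes the range of the other, so \<open>P ** Q = Q\<close> and
  \<open>Q ** P = P\<close>. Since \<open>P ** Q = Q\<close> is Hermitian, \<open>P\<close> and
  \<open>Q\<close> commute, and hence agree.\<close>

lemma orth_projector_eqI:
  assumes P: "hermitian P" "P ** P = P" "range ((*v) P) = S"
  shows "orth_projector S = P"
  unfolding orth_projector_def
proof (rule the_equality)
  show "hermitian P \<and> P ** P = P \<and> range (\<lambda>v. P *v v) = S"
    using P by simp
next
  fix Q assume Q: "hermitian Q \<and> Q ** Q = Q \<and> range (\<lambda>v. Q *v v) = S"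
  have "P ** Q = Q" "Q ** P = P"
    using P Q by (auto intro!: idempotent_fixes_range)
  then show "Q = P"
    using hermitian_mult_swap[of P Q] P Q by simp
qed

section \<open>Spectral decomposition along an orthonormal family\<close>

definition orthonormal_on :: "'k set \<Rightarrow> ('k \<Rightarrow> complex^'n) \<Rightarrow> bool" where
  "orthonormal_on K u \<longleftrightarrow> (\<forall>j\<in>K. \<forall>k\<in>K. cdot (u j) (u k) = (if j = k then 1 else 0))"

text \<open>For an orthonormal family this is a spectral decomposition in which the family need not
  span: the matrix vanishes on the orthogonal complement.\<close>

definition diag_on :: "'k set \<Rightarrow> ('k \<Rightarrow> complex^'n) \<Rightarrow> ('k \<Rightarrow> real) \<Rightarrow> complex^'n^'n" where
  "diag_on K u c = (\<Sum>k\<in>K. c k *\<^sub>R ketbra (u k) (u k))"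

definition proj_on :: "'k set \<Rightarrow> ('k \<Rightarrow> complex^'n) \<Rightarrow> complex^'n^'n" where
  "proj_on K u = (\<Sum>k\<in>K. ketbra (u k) (u k))"

lemma diag_on_mult_vec:
  "diag_on K u c *v v = (\<Sum>k\<in>K. (complex_of_real (c k) * cdot (u k) v) *s u k)"
  by (simp add: diag_on_def sum_matrix_vector_mult scaleR_matrix_vector_mult ketbra_mult_vec
      vec_eq_iff mult.assoc)

lemma proj_on_mult_vec: "proj_on K u *v v = (\<Sum>k\<in>K. cdot (u k) v *s u k)"
  by (simp add: proj_on_def sum_matrix_vector_mult ketbra_mult_vec)

text \<open>Coefficient extraction. The sum runs over a subset \<open>L\<close> so that a vector
  supported on the indices of one eigenvalue can be paired with every member of the whole
  family.\<close>

lemma cdot_orthonormal_sum: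
  assumes "finite K" "orthonormal_on K u" "j \<in> K" "L \<subseteq> K"
  shows "cdot (u j) (\<Sum>k\<in>L. a k *s u k) = (if j \<in> L then a j else 0)"
proof -
  have "finite L" using finite_subset assms(1,4) by metis
  have "cdot (u j) (\<Sum>k\<in>L. a k *s u k) = (\<Sum>k\<in>L. if j = k then a k else 0)"
    unfolding cdot_sum_right cdot_scale_right
  proof (rule sum.cong[OF refl])
    fix k assume "k \<in> L"
    then have "cdot (u j) (u k) = (if j = k then 1 else 0)"
      using assms unfolding orthonormal_on_def by blast
    then show "a k * cdot (u j) (u k) = (if j = k then a k else 0)" by simp
  qed
  then show ?thesis using \<open>finite L\<close> by simp
qed

text \<open>For \<eta> = 0 the eigenspace would also contain the orthogonal complement of the
  family. For \<eta> \<noteq> 0 an eigenvector is recovered from its coefficients on the family by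
  cancelling \<eta>.\<close>

lemma eigenspace_diag_on:
  assumes "finite K" "orthonormal_on K u" "\<eta> \<noteq> 0"
  shows "eigenspace (diag_on K u c) \<eta> = range ((*v) (proj_on {k\<in>K. c k = \<eta>} u))"
    (is "?E = range ((*v) ?P)")
proof
  show "?E \<subseteq> range ((*v) ?P)"
  proof
    fix v assume "v \<in> ?E"
    then have v: "(\<Sum>k\<in>K. (complex_of_real (c k) * cdot (u k) v) *s u k) = complex_of_real \<eta> *s v"
      by (simp add: eigenspace_def diag_on_mult_vec)
    \<comment> \<open>Pairing the eigenvalue equation with \<open>u j\<close> multiplies the
      coefficient by \<open>c j\<close> on one side and by \<eta> on the other.\<close>
    have z: "cdot (u j) v = 0" if "j \<in> K" "c j \<noteq> \<eta>" for j
    proof -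
      have "complex_of_real (c j) * cdot (u j) v = complex_of_real \<eta> * cdot (u j) v"
        using arg_cong[OF v, of "cdot (u j)"]
          cdot_orthonormal_sum[OF assms(1,2) that(1) subset_refl] that(1)
        by (simp add: cdot_scale_right)
      then show ?thesis using that by simp
    qed
    have "complex_of_real \<eta> *s v =
        (\<Sum>k\<in>{k\<in>K. c k = \<eta>}. (complex_of_real (c k) * cdot (u k) v) *s u k)"
      unfolding v[symmetric]
      by (rule sum.mono_neutral_right) (use assms z in \<open>auto simp: vec_eq_iff\<close>)
    also have "\<dots> = (\<Sum>k\<in>{k\<in>K. c k = \<eta>}. complex_of_real \<eta> *s (cdot (u k) v *s u k))"
      by (rule sum.cong) (auto simp: vec_eq_iff)
    also have "\<dots> = complex_of_real \<eta> *s (?P *v v)"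
      by (simp add: proj_on_mult_vec vec.scale_sum_right)
    finally have "v = ?P *v v"
      using assms(3) by simp
    then show "v \<in> range ((*v) ?P)" by blast
  qed
next
  show "range ((*v) ?P) \<subseteq> ?E"
  proof clarify
    fix v
    let ?L = "{k\<in>K. c k = \<eta>}"
    have "diag_on K u c *v (?P *v v) =
        (\<Sum>k\<in>K. (complex_of_real (c k) * (if k \<in> ?L then cdot (u k) v else 0)) *s u k)"
      unfolding diag_on_mult_vec
    proof (intro sum.cong refl)
      fix k assume "k \<in> K"
      then have "cdot (u k) (?P *v v) = (if k \<in> ?L then cdot (u k) v else 0)"
        unfolding proj_on_mult_vec by (intro cdot_orthonormal_sum[where K=K]) (use assms in auto)
      then show "(complex_of_real (c k) * cdot (u k) (?P *v v)) *s u k =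
        (complex_of_real (c k) * (if k \<in> ?L then cdot (u k) v else 0)) *s u k" by simp
    qed
    also have "\<dots> = (\<Sum>k\<in>?L. complex_of_real \<eta> *s (cdot (u k) v *s u k))"
      by (rule sum.mono_neutral_cong_right) (use assms in \<open>auto simp: vec_eq_iff\<close>)
    also have "\<dots> = complex_of_real \<eta> *s (?P *v v)"
      by (simp add: proj_on_mult_vec vec.scale_sum_right)
    finally show "?P *v v \<in> ?E" by (simp add: eigenspace_def)
  qed
qed

lemma hermitian_proj_on: "hermitian (proj_on K u)"
  unfolding proj_on_def by (intro hermitian_sum hermitian_ketbra)

lemma proj_on_idempotent:
  assumes "finite K" "orthonormal_on K u"
  shows "proj_on K u ** proj_on K u = proj_on K u"
proof -
  have "proj_on K u *v (proj_on K u *v v) = proj_on K u *v v" for v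
  proof -
    have "cdot (u k) (\<Sum>j\<in>K. cdot (u j) v *s u j) = cdot (u k) v" if "k \<in> K" for k
      using cdot_orthonormal_sum[OF assms that subset_refl] that by simp
    then show ?thesis by (simp add: proj_on_mult_vec)
  qed
  then show ?thesis by (simp add: matrix_eq matrix_vector_mul_assoc[symmetric])
qed

text \<open>At \<eta> = 0 the scalar factor annihilates both sides, so the eigenspace is only needed
  for \<eta> \<noteq> 0.\<close>

lemma spectral_part_diag_on:
  assumes "finite K" "orthonormal_on K u"
  shows "spectral_part (diag_on K u c) \<eta> = \<eta> *\<^sub>R proj_on {k\<in>K. c k = \<eta>} u"
proof (cases "\<eta> = 0")
  case False
  have "orthonormal_on {k\<in>K. c k = \<eta>} u"
    using assms(2) by (auto simp: orthonormal_on_def)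
  then have "orth_projector (eigenspace (diag_on K u c) \<eta>) = proj_on {k\<in>K. c k = \<eta>} u"
    using assms False
    by (intro orth_projector_eqI hermitian_proj_on proj_on_idempotent)
      (auto simp: eigenspace_diag_on)
  then show ?thesis by (simp add: spectral_part_def)
qed (simp add: spectral_part_def)

section \<open>Vanishing of \<open>M\<close> when partial traces are idempotent\<close>

lemma eigenvalues_scaled_idempotent:
  assumes "Q ** Q = Q"
  shows "eigenvalues (\<eta> *\<^sub>R Q) \<subseteq> {0, \<eta>}"
proof
  fix l assume "l \<in> eigenvalues (\<eta> *\<^sub>R Q)"
  then obtain v where v: "v \<noteq> 0" "complex_of_real \<eta> *s (Q *v v) = complex_of_real l *s v"
    by (auto simp: eigenvalues_def eigenspace_def scaleR_matrix_vector_mult)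
  \<comment> \<open>Applying \<open>Q\<close> to the eigenvalue equation leaves the left side
    unchanged. If \<open>Q *v v = 0\<close>, the original equation forces \<open>l = 0\<close>;
    otherwise the scalars agree.\<close>
  have "complex_of_real \<eta> *s (Q *v v) = complex_of_real l *s (Q *v v)"
    using arg_cong[OF v(2), of "(*v) Q"] assms
    by (simp add: matrix_vector_mul_assoc vec.scale)
  then have "Q *v v = 0 \<or> l = \<eta>" by auto
  then show "l \<in> {0, \<eta>}" using v by auto
qed

lemma nim_self: "nim \<eta> \<eta> = \<eta>"
  by (simp add: nim_def)

lemma ptrace_B_scaleR: "ptrace_B (r *\<^sub>R R) = r *\<^sub>R ptrace_B R"
  by (simp add: vec_eq_iff ptrace_B_def scaleR_sum_right)

lemma ptrace_A_scaleR: "ptrace_A (r *\<^sub>R R) = r *\<^sub>R ptrace_A R"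
  by (simp add: vec_eq_iff ptrace_A_def scaleR_sum_right)

text \<open>Each nonzero eigenvalue of a reduced spectral part equals \<eta>, which
  \<open>nim\<close> fixes, so the factor with the absolute value is zero. Neither the logarithms
  nor the multiplicities have to be computed.\<close>

lemma M_diag_on_eq_0:
  assumes "finite K" "orthonormal_on K u"
    and QB: "\<And>\<eta>. ptrace_B (proj_on {k\<in>K. c k = \<eta>} u) ** ptrace_B (proj_on {k\<in>K. c k = \<eta>} u)
          = ptrace_B (proj_on {k\<in>K. c k = \<eta>} u)"
    and QA: "\<And>\<eta>. ptrace_A (proj_on {k\<in>K. c k = \<eta>} u) ** ptrace_A (proj_on {k\<in>K. c k = \<eta>} u)
          = ptrace_A (proj_on {k\<in>K. c k = \<eta>} u)"
  shows "M (diag_on K u c) = 0"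
proof -
  have "l = \<eta>" if "l \<in> eigenvalues (ptrace_B (spectral_part (diag_on K u c) \<eta>)) - {0}" for l \<eta>
    using that eigenvalues_scaled_idempotent[OF QB]
    by (auto simp: spectral_part_diag_on[OF assms(1,2)] ptrace_B_scaleR)
  then have "M_A (diag_on K u c) = 0"
    unfolding M_A_def neg_equal_0_iff_equal
    by (intro sum.neutral ballI) (metis abs_0 diff_self mult_zero_left mult_zero_right nim_self)
  moreover have "l = \<eta>" if "l \<in> eigenvalues (ptrace_A (spectral_part (diag_on K u c) \<eta>)) - {0}" for l \<eta>
    using that eigenvalues_scaled_idempotent[OF QA]
    by (auto simp: spectral_part_diag_on[OF assms(1,2)] ptrace_A_scaleR)
  then have "M_B (diag_on K u c) = 0"
    unfolding M_B_def neg_equal_0_iff_equal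
    by (intro sum.neutral ballI) (metis abs_0 diff_self mult_zero_left mult_zero_right nim_self)
  ultimately show ?thesis by (simp add: M_def)
qed

section \<open>Density matrices built from orthonormal families\<close>

lemma trace_ketbra: "trace (ketbra u u) = cdot u u"
  by (simp add: trace_def ketbra_def cdot_def mult.commute)

lemma trace_diag_on: "trace (diag_on K u c) = (\<Sum>k\<in>K. complex_of_real (c k) * cdot (u k) (u k))"
proof -
  have "trace (diag_on K u c) = (\<Sum>k\<in>K. complex_of_real (c k) * trace (ketbra (u k) (u k)))"
    unfolding trace_def diag_on_def
    by (simp add: sum_distrib_left scaleR_conv_of_real[where 'a=complex]) (rule sum.swap)
  then show ?thesis by (simp add: trace_ketbra)
qed

lemma density_matrix_diag_on:
  assumes "orthonormal_on K u" "\<And>k. k \<in> K \<Longrightarrow> 0 \<le> c k" "(\<Sum>k\<in>K. c k) = 1"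
  shows "density_matrix (diag_on K u c)"
  unfolding density_matrix_def
proof (intro conjI allI)
  show "hermitian (diag_on K u c)"
    unfolding diag_on_def by (intro hermitian_sum hermitian_scaleR hermitian_ketbra)
  show "0 \<le> Re (cdot v (diag_on K u c *v v))" for v
  proof -
    \<comment> \<open>The quadratic form is a sum of squared moduli weighted by the
      \<open>c k\<close>, which gives positivity.\<close>
    have "cdot v (diag_on K u c *v v) =
        (\<Sum>k\<in>K. complex_of_real (c k * (cmod (cdot (u k) v))\<^sup>2))"
      unfolding of_real_mult complex_norm_square cnj_cdot
      by (simp add: diag_on_mult_vec cdot_sum_right cdot_scale_right mult.assoc)
    then show ?thesis using assms(2) by (auto intro!: sum_nonneg)
  qed
  have "trace (diag_on K u c) = (\<Sum>k\<in>K. complex_of_real (c k))"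
    unfolding trace_diag_on using assms(1) by (intro sum.cong) (simp_all add: orthonormal_on_def)
  then show "trace (diag_on K u c) = 1"
    using assms(3) by (metis of_real_1 of_real_sum)
qed

section \<open>Product eigenbases and commuting blocks\<close>

definition block :: "complex^('a::finite \<times> 'b::finite)^('a \<times> 'b) \<Rightarrow> 'a \<Rightarrow> 'a \<Rightarrow> complex^'b^'b" where
  "block R i j = (\<chi> k l. R $ (i, k) $ (j, l))"

lemma product_eigenbasis_blocks_commute:
  fixes R :: "complex^('a::finite \<times> 'b::finite)^('a \<times> 'b)"
  assumes "has_product_eigenbasis R"
  shows "block R i j ** block R i' j' = block R i' j' ** block R i j"
proof -
  obtain v :: "'a \<Rightarrow> complex^'a" and w :: "'b \<Rightarrow> complex^'b" and e where w: "orthonormal_basis w"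
    and R: "R = (\<Sum>j\<in>UNIV. \<Sum>k\<in>UNIV. e j k *\<^sub>R mat_tensor (ketbra (v j) (v j)) (ketbra (w k) (w k)))"
    using assms unfolding has_product_eigenbasis_def by blast
  \<comment> \<open>\<open>f i j k\<close> is the eigenvalue of \<open>block R i j\<close> at
    \<open>w k\<close>; it may be complex when \<open>i\<close> and \<open>j\<close> differ.\<close>
  define f where "f i j k = (\<Sum>m\<in>UNIV. complex_of_real (e m k) * (v m $ i * cnj (v m $ j)))" for i j k
  have block_vec: "block R i j *v x = (\<Sum>k\<in>UNIV. (f i j k * cdot (w k) x) *s w k)" for i j x
  proof -
    have "block R i j $ a $ b = (\<Sum>k\<in>UNIV. f i j k * (w k $ a * cnj (w k $ b)))" for a b
      unfolding R block_def f_def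
      by (simp add: mat_tensor_def ketbra_def scaleR_conv_of_real[where 'a=complex] sum_distrib_left
          mult_ac) (rule sum.swap)
    then show ?thesis
      by (simp add: vec_eq_iff matrix_vector_mult_def cdot_def sum_distrib_left sum_distrib_right
          mult_ac) (intro allI sum.swap)
  qed
  \<comment> \<open>Blocks multiply the coordinates with respect to \<open>w\<close> by scalars, so
    applying two of them in either order gives the same products.\<close>
  have "cdot (w k) (block R i j *v x) = f i j k * cdot (w k) x" for k i j x
    unfolding block_vec
    using cdot_orthonormal_sum[of UNIV w k UNIV] w
    by (simp add: orthonormal_on_def orthonormal_basis_def)
  then have "block R i j *v (block R i' j' *v x) = block R i' j' *v (block R i j *v x)" for x
    by (simp add: block_vec[of _ _ "_ *v _"] mult_ac)
  then show ?thesis by (simp add: matrix_eq matrix_vector_mul_assoc[symmetric])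
qed

section \<open>Zero diagonal entries of density and separable matrices\<close>

lemma mult_vec_axis: "A *v axis i 1 = column i A"
  for A :: "complex^'n^'m"
  by (simp add: vec_eq_iff matrix_vector_mult_def column_def axis_def if_distrib cong: if_cong)

lemma cdot_axis_left: "cdot (axis i 1) y = y $ i"
proof -
  have "cdot (axis i 1) y = (\<Sum>k\<in>UNIV. if k = i then y $ k else 0)"
    unfolding cdot_def by (rule sum.cong) (auto simp: axis_def)
  then show ?thesis by simp
qed

lemma density_matrix_diag_nonneg:
  assumes "density_matrix A"
  shows "0 \<le> Re (A $ i $ i)" "Im (A $ i $ i) = 0"
proof -
  have "cdot (axis i 1) (A *v axis i 1) = A $ i $ i"
    by (simp add: cdot_axis_left mult_vec_axis column_def)
  then show "0 \<le> Re (A $ i $ i)"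
    using assms unfolding density_matrix_def by metis
  have "A $ i $ i = cnj (A $ i $ i)"
    using assms unfolding density_matrix_def hermitian_def by metis
  then show "Im (A $ i $ i) = 0" by (metis complex_cnj_cancel_iff complex_is_Real_iff Reals_cnj_iff)
qed

text \<open>On the span of two basis vectors, a zero diagonal entry leaves the quadratic form with
  no term quadratic in the \<open>i\<close>-th coordinate. A nonzero off-diagonal entry would then
  make the form negative far out in that coordinate.\<close>

lemma density_matrix_zero_diag:
  assumes A: "density_matrix A" and z: "A $ i $ i = 0"
  shows "A $ i $ j = 0"
proof (cases "i = j")
  case False
  let ?q = "(cmod (A $ i $ j))\<^sup>2"
  have h: "A $ j $ i = cnj (A $ i $ j)"
    using A unfolding density_matrix_def hermitian_def by blast
  have *: "0 \<le> Re (A $ j $ j) - 2 * s * ?q" for s :: real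
  proof -
    \<comment> \<open>This phase makes both cross terms equal to \<open>- s * ?q\<close>, so the
      form is affine in \<open>s\<close>.\<close>
    define t where "t = - (complex_of_real s * A $ i $ j)"
    have Ax: "A *v (t *s axis i 1 + axis j 1) = t *s column i A + column j A"
      by (simp add: matrix_vector_right_distrib vec.scale mult_vec_axis)
    have "cdot (t *s axis i 1 + axis j 1) y = cnj t * cdot (axis i 1) y + cdot (axis j 1) y" for y
      by (simp add: cdot_def algebra_simps sum.distrib sum_distrib_left)
    then have "cdot (t *s axis i 1 + axis j 1) (A *v (t *s axis i 1 + axis j 1)) =
        cnj t * A $ i $ j + t * A $ j $ i + A $ j $ j"
      unfolding Ax by (simp add: cdot_axis_left column_def z algebra_simps)
    also have "\<dots> = A $ j $ j - complex_of_real (2 * s * ?q)"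
      unfolding h t_def of_real_mult complex_norm_square by (simp add: algebra_simps)
    finally show ?thesis
      using A unfolding density_matrix_def by (metis Re_complex_of_real minus_complex.simps(1))
  qed
  show ?thesis
  proof (rule ccontr)
    assume "A $ i $ j \<noteq> 0"
    \<comment> \<open>This \<open>s\<close> turns the form into \<open>- Re (A $ j $ j) - 2\<close>,
      which is negative because the choice \<open>s = 0\<close> shows the diagonal entry to be
      nonnegative.\<close>
    then have "2 * ((Re (A $ j $ j) + 1) / ?q) * ?q = 2 * (Re (A $ j $ j) + 1)" by simp
    then have "0 \<le> Re (A $ j $ j) - 2 * (Re (A $ j $ j) + 1)"
      using *[of "(Re (A $ j $ j) + 1) / ?q"] by simp
    moreover have "0 \<le> Re (A $ j $ j)" using *[of 0] by simp
    ultimately show False by argo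
  qed
qed (use z in simp)

text \<open>An instance of the positive partial transpose criterion:
  \<open>R $ (i, l) $ (j, k)\<close> is the entry at \<open>(i, k)\<close>, \<open>(j, l)\<close> of
  the partial transpose on B, whose diagonal agrees with that of \<open>R\<close>. The proof argues
  on each term of the mixture.\<close>

lemma separable_zero_diag:
  assumes "separable R" and z: "R $ (i, k) $ (i, k) = 0"
  shows "R $ (i, l) $ (j, k) = 0"
proof -
  obtain n :: nat and p A B where
    d: "\<And>m. m < n \<Longrightarrow> 0 \<le> p m \<and> density_matrix (A m) \<and> density_matrix (B m)"
    and R: "R = (\<Sum>m<n. p m *\<^sub>R mat_tensor (A m) (B m))"
    using assms(1) unfolding separable_def by blast
  have R_nth: "R $ (a, b) $ (a', b') = (\<Sum>m<n. complex_of_real (p m) * (A m $ a $ a' * B m $ b $ b'))"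
    for a b a' b'
    unfolding R by (simp add: mat_tensor_def scaleR_conv_of_real[where 'a=complex])
  \<comment> \<open>The contributions of the single terms to the diagonal entry of \<open>R\<close>.
    They are nonnegative and sum to zero, so each vanishes.\<close>
  let ?x = "\<lambda>m. p m * (Re (A m $ i $ i) * Re (B m $ k $ k))"
  have "(\<Sum>m<n. ?x m) = Re (R $ (i, k) $ (i, k))"
    unfolding R_nth Re_sum
  proof (rule sum.cong[OF refl])
    fix m assume "m \<in> {..<n}"
    then have "Im (A m $ i $ i) = 0" "Im (B m $ k $ k) = 0"
      using d density_matrix_diag_nonneg(2) by blast+
    then show "?x m = Re (complex_of_real (p m) * (A m $ i $ i * B m $ k $ k))" by simp
  qed
  then have "(\<Sum>m<n. ?x m) = 0" using z by simp
  moreover have "0 \<le> ?x m" if "m < n" for m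
    using d[OF that] density_matrix_diag_nonneg by (metis mult_nonneg_nonneg)
  ultimately have x0: "?x m = 0" if "m < n" for m
    using that by (subst (asm) sum_nonneg_eq_0_iff) auto
  have "complex_of_real (p m) * (A m $ i $ j * B m $ l $ k) = 0" if "m < n" for m
  proof -
    note dm = d[OF that]
    have "p m = 0 \<or> A m $ i $ i = 0 \<or> B m $ k $ k = 0"
      using x0[OF that] density_matrix_diag_nonneg(2)[of "A m" i]
        density_matrix_diag_nonneg(2)[of "B m" k] dm
      by (auto simp: complex_eq_iff)
    moreover have "A m $ i $ j = 0" if "A m $ i $ i = 0"
      using density_matrix_zero_diag that dm by blast
    \<comment> \<open>The entry wanted here lies in the column of the zero diagonal entry, so
      Hermiticity carries it over from the row.\<close>
    moreover have "B m $ l $ k = 0" if "B m $ k $ k = 0"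
    proof -
      have "B m $ k $ l = 0" using density_matrix_zero_diag that dm by blast
      then show ?thesis using dm unfolding density_matrix_def hermitian_def
        by (metis complex_cnj_zero)
    qed
    ultimately show ?thesis by auto
  qed
  then show ?thesis unfolding R_nth by (intro sum.neutral ballI) simp
qed

section \<open>Product vectors and their partial traces\<close>

lemma cdot_vec_tensor: "cdot (vec_tensor v w) (vec_tensor v' w') = cdot v v' * cdot w w'"
  by (simp add: cdot_def vec_tensor_def sum_product sum.cartesian_product mult_ac
      split_beta flip: UNIV_Times_UNIV)

lemma ptrace_B_zero: "ptrace_B 0 = 0"
  by (simp add: vec_eq_iff ptrace_B_def)

lemma ptrace_A_zero: "ptrace_A 0 = 0"
  by (simp add: vec_eq_iff ptrace_A_def)

lemma ptrace_B_ketbra_vec_tensor: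
  assumes "cdot w w = 1"
  shows "ptrace_B (ketbra (vec_tensor v w) (vec_tensor v w)) = ketbra v v"
proof -
  have "ptrace_B (ketbra (vec_tensor v w) (vec_tensor v w)) $ i $ j = ketbra v v $ i $ j * cdot w w"
    for i j
    by (simp add: ptrace_B_def ketbra_def vec_tensor_def cdot_def sum_distrib_left mult_ac)
  then show ?thesis using assms by (simp add: vec_eq_iff)
qed

lemma ptrace_A_ketbra_vec_tensor:
  assumes "cdot v v = 1"
  shows "ptrace_A (ketbra (vec_tensor v w) (vec_tensor v w)) = ketbra w w"
proof -
  have "ptrace_A (ketbra (vec_tensor v w) (vec_tensor v w)) $ i $ j = ketbra w w $ i $ j * cdot v v"
    for i j
    by (simp add: ptrace_A_def ketbra_def vec_tensor_def cdot_def sum_distrib_left mult_ac)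
  then show ?thesis using assms by (simp add: vec_eq_iff)
qed

text \<open>Injectivity of \<open>c\<close> leaves at most one product vector for each \<eta>. The
  spectral projector is thus zero or a rank-one product projector, whose partial traces are again
  rank-one projectors.\<close>

lemma M_product_vectors_eq_0:
  fixes a :: "'k \<Rightarrow> complex^('a::finite)" and b :: "'k \<Rightarrow> complex^('b::finite)"
  assumes "finite K" "orthonormal_on K (\<lambda>k. vec_tensor (a k) (b k))" "inj_on c K"
    and unit: "\<And>k. k \<in> K \<Longrightarrow> cdot (a k) (a k) = 1 \<and> cdot (b k) (b k) = 1"
  shows "M (diag_on K (\<lambda>k. vec_tensor (a k) (b k)) c) = 0"
proof -
  let ?P = "\<lambda>\<eta>. proj_on {k \<in> K. c k = \<eta>} (\<lambda>k. vec_tensor (a k) (b k))"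
  have P: "?P \<eta> = 0 \<or> (\<exists>k\<in>K. ?P \<eta> = ketbra (vec_tensor (a k) (b k)) (vec_tensor (a k) (b k)))" for \<eta>
  proof (cases "\<exists>k\<in>K. c k = \<eta>")
    case True
    then obtain k where k: "k \<in> K" "c k = \<eta>" by blast
    then have "{k \<in> K. c k = \<eta>} = {k}" using assms(3) by (auto dest: inj_onD)
    then show ?thesis using k(1) by (auto simp: proj_on_def)
  next
    case False
    then have "{k \<in> K. c k = \<eta>} = {}" by blast
    then show ?thesis by (simp only: proj_on_def sum.empty simp_thms)
  qed
  show ?thesis
  proof (rule M_diag_on_eq_0[OF assms(1,2)])
    show "ptrace_B (?P \<eta>) ** ptrace_B (?P \<eta>) = ptrace_B (?P \<eta>)" for \<eta>
      using P[of \<eta>] unit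
      by (auto simp: ptrace_B_zero ptrace_A_zero times0_left ptrace_B_ketbra_vec_tensor ketbra_idempotent)
    show "ptrace_A (?P \<eta>) ** ptrace_A (?P \<eta>) = ptrace_A (?P \<eta>)" for \<eta>
      using P[of \<eta>] unit
      by (auto simp: ptrace_B_zero ptrace_A_zero times0_left ptrace_A_ketbra_vec_tensor ketbra_idempotent)
  qed
qed

section \<open>The index types \<open>2\<close> and \<open>3\<close>\<close>

lemma UNIV_2_eq: "(UNIV :: 2 set) = {0, 1}"
  using UNIV_2 by auto

lemma add_one_3: "(1::3) + 1 = 2" "(2::3) + 1 = 0"
  by simp_all

lemma distinct_3: "(0::3) \<noteq> 1" "(0::3) \<noteq> 2" "(1::3) \<noteq> 2"
  by simp_all

lemma sum_UNIV_3: "(\<Sum>i\<in>UNIV. f i) = f 0 + f 1 + f (2::3)"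
proof -
  have *: "UNIV = {0, 1, 2 :: 3}" using UNIV_3 by auto
  show ?thesis unfolding * using distinct_3 by (simp add: add.assoc)
qed

lemma neq_add_one_3: "i \<noteq> i + 1" for i :: 3
  by simp

lemma cdot_ket: "cdot (ket i) x = x $ i"
  by (simp add: ket_def cdot_axis_left)

section \<open>The two-qubit state \<sigma>\<close>

definition \<sigma>_A :: "nat \<Rightarrow> complex^2" where
  "\<sigma>_A k = (if k = 3 then ket 1 else ket 0)"

definition \<sigma>_B :: "nat \<Rightarrow> complex^2" where
  "\<sigma>_B k = (if k = 1 then ket 0 else if k = 2 then ket 1 else ket_plus)"

text \<open>The index is chosen to be the weight of its vector, so the eigenvalues
  \<open>k / 6\<close> are visibly distinct.\<close>

lemma \<sigma>_eq_diag_on: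
  "\<sigma> = diag_on {1, 2, 3} (\<lambda>k. vec_tensor (\<sigma>_A k) (\<sigma>_B k)) (\<lambda>k. real k / 6)"
  by (simp add: \<sigma>_def Let_def diag_on_def \<sigma>_A_def \<sigma>_B_def scaleR_add_right)

lemma cdot_ket_plus: "cdot ket_plus ket_plus = 1"
  by (simp add: cdot_def UNIV_2_eq ket_plus_def ket_def axis_def scaleR_conv_of_real[where 'a=complex]
      flip: of_real_mult)

lemma cdot_\<sigma>_A: "cdot (\<sigma>_A k) (\<sigma>_A k) = 1"
  by (simp add: \<sigma>_A_def cdot_ket) (simp add: ket_def axis_def)

lemma cdot_\<sigma>_B: "cdot (\<sigma>_B k) (\<sigma>_B k) = 1"
  by (simp add: \<sigma>_B_def cdot_ket cdot_ket_plus) (simp add: ket_def axis_def)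

text \<open>Index 3 is orthogonal to 1 and 2 through the first factor, since \<open>ket_plus\<close>
  overlaps both kets of the second; 1 and 2 are separated by the second factor.\<close>

lemma orthonormal_on_\<sigma>: "orthonormal_on {1, 2, 3} (\<lambda>k. vec_tensor (\<sigma>_A k) (\<sigma>_B k))"
  unfolding orthonormal_on_def cdot_vec_tensor
  by (simp add: cdot_\<sigma>_A cdot_\<sigma>_B) (simp add: \<sigma>_A_def \<sigma>_B_def cdot_ket, simp add: ket_def axis_def)

lemma density_matrix_\<sigma>: "density_matrix \<sigma>"
  unfolding \<sigma>_eq_diag_on by (rule density_matrix_diag_on[OF orthonormal_on_\<sigma>]) auto

lemma M_\<sigma>: "M \<sigma> = 0"
  unfolding \<sigma>_eq_diag_on
  by (rule M_product_vectors_eq_0[OF _ orthonormal_on_\<sigma>])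
    (auto simp: cdot_\<sigma>_A cdot_\<sigma>_B inj_on_def)

lemma no_product_eigenbasis_\<sigma>: "\<not> has_product_eigenbasis \<sigma>"
proof
  assume "has_product_eigenbasis \<sigma>"
  \<comment> \<open>The first block is diagonal with entries 1/6 and 1/3; the second is half the
    projector onto \<open>ket_plus\<close>, with off-diagonal entry 1/4. The two products have 1/24
    and 1/12 in this position.\<close>
  then have "(block \<sigma> 0 0 ** block \<sigma> 1 1) $ 0 $ 1 = (block \<sigma> 1 1 ** block \<sigma> 0 0) $ 0 $ 1"
    by (simp add: product_eigenbasis_blocks_commute)
  moreover have "\<sigma> $ (0, 0) $ (0, 0) = 1 / 6" "\<sigma> $ (0, 0) $ (0, 1) = 0"
    "\<sigma> $ (0, 1) $ (0, 1) = 1 / 3" "\<sigma> $ (1, 0) $ (1, 1) = 1 / 4"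
    by (simp_all add: \<sigma>_def Let_def ketbra_def vec_tensor_def ket_def ket_plus_def axis_def
        scaleR_conv_of_real[where 'a=complex] flip: of_real_mult)
  ultimately show False
    by (simp add: block_def matrix_matrix_mult_def UNIV_2_eq)
qed

section \<open>The two-qutrit state \<tau>\<close>

lemma sym_pair_nth:
  assumes "i \<noteq> j"
  shows "sym_pair i j $ p = (if p = (i, j) \<or> p = (j, i) then complex_of_real (1 / sqrt 2) else 0)"
  using assms
  by (cases p) (auto simp: sym_pair_def vec_tensor_def ket_def axis_def scaleR_conv_of_real[where 'a=complex])

lemma ketbra_sym_pair_nth:
  assumes "i \<noteq> j"
  shows "ketbra (sym_pair i j) (sym_pair i j) $ p $ q =
    (if p \<in> {(i, j), (j, i)} \<and> q \<in> {(i, j), (j, i)} then 1 / 2 else 0)"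
proof -
  have "complex_of_real (1 / sqrt 2) * complex_of_real (1 / sqrt 2) = 1 / 2"
    by (simp flip: of_real_mult)
  then show ?thesis by (simp add: ketbra_def sym_pair_nth[OF assms] del: of_real_divide)
qed

text \<open>Addition in \<open>3\<close> is modulo 3, so the cyclic pairs \<open>(i, i + 1)\<close>
  are (0,1), (1,2), (2,0), matching the three vectors in the definition.\<close>

lemma \<tau>_eq_diag_on: "\<tau> = diag_on UNIV (\<lambda>i. sym_pair i (i + 1)) (\<lambda>_. 1 / 3)"
  by (simp only: \<tau>_def Let_def diag_on_def sum_UNIV_3 add_one_3 add_0_left scaleR_add_right)

text \<open>The four overlaps of product kets agree in pairs, which cancels the normalization 1/2.
  For equal indices both summands count, as \<open>sym_pair i i\<close> has squared norm 2.\<close>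

lemma cdot_sym_pair:
  "cdot (sym_pair i j) (sym_pair k l) =
    (if i = k \<and> j = l then 1 else 0) + (if i = l \<and> j = k then 1 else 0)"
proof -
  have eq: "cdot (r *\<^sub>R (x + y)) (r *\<^sub>R (x' + y')) =
      complex_of_real (r * r) * (cdot x x' + cdot x y' + cdot y x' + cdot y y')"
    for r :: real and x y x' y' :: "complex^(3 \<times> 3)"
    by (simp add: cdot_def scaleR_conv_of_real[where 'a=complex] algebra_simps sum.distrib
        sum_distrib_left)
  have kets: "cdot (ket i) (ket j) = (if i = j then 1 else 0)" for i j :: 3
    by (simp add: cdot_ket) (simp add: ket_def axis_def)
  have half: "complex_of_real (1 / sqrt 2 * (1 / sqrt 2)) = 1 / 2"
    by simp
  have conj: "(if P then 1 else 0) * (if Q then 1 else 0) = (if P \<and> Q then 1 else 0 :: complex)" for P Q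
    by simp
  have double: "1 / 2 * (x + y + y + x) = x + y" for x y :: complex
    by (simp add: field_simps)
  show ?thesis
    unfolding sym_pair_def eq cdot_vec_tensor kets half conj conj_commute[of "j = k"]
      conj_commute[of "j = l"] by (rule double)
qed

lemma orthonormal_on_\<tau>: "orthonormal_on UNIV (\<lambda>i. sym_pair i (i + 1))"
proof -
  have "(if i = j then 1 else 0) + (if i = j + 1 \<and> i + 1 = j then 1 else 0) =
      (if i = j then 1 else 0 :: complex)" for i j :: 3
  proof -
    \<comment> \<open>A match of two cyclic pairs in swapped order would force 2 = 0 modulo
      3.\<close>
    have "i + 1 + 1 \<noteq> i" by (simp add: add.assoc)
    then show ?thesis by auto
  qed
  then show ?thesis by (simp add: orthonormal_on_def cdot_sym_pair)
qed

lemma ptrace_ketbra_sym_pair: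
  assumes "i \<noteq> j"
  shows "ptrace_B (ketbra (sym_pair i j) (sym_pair i j)) $ a $ b =
      (if a = b \<and> (a = i \<or> a = j) then 1 / 2 else 0)"
    and "ptrace_A (ketbra (sym_pair i j) (sym_pair i j)) $ a $ b =
      (if a = b \<and> (a = i \<or> a = j) then 1 / 2 else 0)"
proof -
  \<comment> \<open>The traced-out index \<open>k\<close> must be the partner of the kept one:
    \<open>j\<close> if \<open>i\<close> is kept, \<open>i\<close> if \<open>j\<close> is kept.
    Symmetry under exchange makes one formula serve both partial traces.\<close>
  let ?f = "\<lambda>k. (if k = j then if a = i \<and> b = i then 1 / 2 else 0 else 0) +
      (if k = i then if a = j \<and> b = j then 1 / 2 else 0 else 0 :: complex)"
  have sum: "sum ?f UNIV = (if a = b \<and> (a = i \<or> a = j) then 1 / 2 else 0)"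
    unfolding sum.distrib using assms by auto
  have "ketbra (sym_pair i j) (sym_pair i j) $ (a, k) $ (b, k) = ?f k"
    "ketbra (sym_pair i j) (sym_pair i j) $ (k, a) $ (k, b) = ?f k" for k
    unfolding ketbra_sym_pair_nth[OF assms] using assms by auto
  then show "ptrace_B (ketbra (sym_pair i j) (sym_pair i j)) $ a $ b =
      (if a = b \<and> (a = i \<or> a = j) then 1 / 2 else 0)"
    "ptrace_A (ketbra (sym_pair i j) (sym_pair i j)) $ a $ b =
      (if a = b \<and> (a = i \<or> a = j) then 1 / 2 else 0)"
    unfolding sum[symmetric] by (simp_all only: ptrace_B_def ptrace_A_def vec_lambda_beta)
qed

lemma ptrace_B_sum: "ptrace_B (\<Sum>k\<in>K. R k) = (\<Sum>k\<in>K. ptrace_B (R k))"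
  by (simp add: vec_eq_iff ptrace_B_def) (intro allI sum.swap)

lemma ptrace_A_sum: "ptrace_A (\<Sum>k\<in>K. R k) = (\<Sum>k\<in>K. ptrace_A (R k))"
  by (simp add: vec_eq_iff ptrace_A_def) (intro allI sum.swap)

text \<open>Each \<open>a\<close> lies in exactly two of the three cyclic pairs, those with
  \<open>i = a\<close> and \<open>i = a - 1\<close>, and each contributes 1/2 to the
  diagonal.\<close>

lemma ptrace_proj_on_\<tau>:
  "ptrace_B (proj_on UNIV (\<lambda>i. sym_pair i (i + 1))) = mat 1"
  "ptrace_A (proj_on UNIV (\<lambda>i. sym_pair i (i + 1))) = mat 1"
proof -
  have "(\<Sum>i\<in>UNIV. if a = b \<and> (a = i \<or> a = i + 1) then 1 / 2 else 0) = (mat 1 :: complex^3^3) $ a $ b"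
    for a b :: 3
  proof -
    have "(if a = b \<and> (a = i \<or> a = i + 1) then 1 / 2 else 0) =
        (if i = a then if a = b then 1 / 2 else 0 else 0) +
        (if i = a - 1 then if a = b then 1 / 2 else 0 else 0 :: complex)" for i
      using neq_add_one_3[of i] by (auto simp: eq_diff_eq)
    then show ?thesis by (simp add: sum.distrib mat_def)
  qed
  note sum = this
  have "ptrace_B (proj_on UNIV (\<lambda>i. sym_pair i (i + 1))) $ a $ b = mat 1 $ a $ b"
    "ptrace_A (proj_on UNIV (\<lambda>i. sym_pair i (i + 1))) $ a $ b = mat 1 $ a $ b" for a b
    unfolding proj_on_def ptrace_B_sum ptrace_A_sum sum_component
      ptrace_ketbra_sym_pair[OF neq_add_one_3] by (rule sum)+
  then show "ptrace_B (proj_on UNIV (\<lambda>i. sym_pair i (i + 1))) = mat 1"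
    "ptrace_A (proj_on UNIV (\<lambda>i. sym_pair i (i + 1))) = mat 1"
    unfolding vec_eq_iff by blast+
qed

lemma density_matrix_\<tau>: "density_matrix \<tau>"
  unfolding \<tau>_eq_diag_on by (rule density_matrix_diag_on[OF orthonormal_on_\<tau>]) auto

lemma M_\<tau>: "M \<tau> = 0"
  unfolding \<tau>_eq_diag_on
proof (rule M_diag_on_eq_0[OF _ orthonormal_on_\<tau>])
  fix \<eta> :: real
  let ?P = "proj_on {k \<in> UNIV. 1 / 3 = \<eta>} (\<lambda>i :: 3. sym_pair i (i + 1))"
  \<comment> \<open>All three vectors share the eigenvalue 1/3, so \<eta> selects the whole family
    or nothing; the partial traces are the identity or zero.\<close>
  have "?P = proj_on UNIV (\<lambda>i. sym_pair i (i + 1)) \<or> ?P = 0"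
    by (cases "1 / 3 = \<eta>") (auto simp: proj_on_def)
  then show "ptrace_B ?P ** ptrace_B ?P = ptrace_B ?P" "ptrace_A ?P ** ptrace_A ?P = ptrace_A ?P"
    by (auto simp: ptrace_proj_on_\<tau> ptrace_B_zero ptrace_A_zero times0_left)
qed simp

lemma \<tau>_nth:
  "\<tau> $ p $ q = (\<Sum>i\<in>UNIV. if p \<in> {(i, i + 1), (i + 1, i)} \<and> q \<in> {(i, i + 1), (i + 1, i)} then 1 / 6 else 0)"
proof -
  have "(1 / 3 :: real) *\<^sub>R (if P then 1 / 2 else 0 :: complex) = (if P then 1 / 6 else 0)" for P
    by (simp add: scaleR_conv_of_real[where 'a=complex])
  then show ?thesis
    by (simp only: \<tau>_eq_diag_on diag_on_def sum_component vector_scaleR_component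
        ketbra_sym_pair_nth[OF neq_add_one_3])
qed

lemma \<tau>_nth_diag: "\<tau> $ (a, a) $ q = 0"
  unfolding \<tau>_nth
proof (rule sum.neutral, intro ballI)
  fix i :: 3
  have "(a, a) \<notin> {(i, i + 1), (i + 1, i)}" using neq_add_one_3[of i] by force
  then show "(if (a, a) \<in> {(i, i + 1), (i + 1, i)} \<and> q \<in> {(i, i + 1), (i + 1, i)}
    then 1 / 6 else 0 :: complex) = 0"
    by (simp only: simp_thms if_False)
qed

lemma \<tau>_nth_01: "\<tau> $ (0, 1) $ q = (if q \<in> {(0, 1), (1, 0)} then 1 / 6 else 0)"
proof -
  have "(0, 1) \<in> {(i, i + 1), (i + 1, i)} \<longleftrightarrow> i = 0" for i :: 3
    using distinct_3 add_one_3(1) by (cases "i = 1") auto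
  then have "(if (0, 1) \<in> {(i, i + 1), (i + 1, i)} \<and> q \<in> {(i, i + 1), (i + 1, i)} then 1 / 6 else 0) =
      (if i = 0 then if q \<in> {(0, 1), (1, 0)} then 1 / 6 else 0 else 0 :: complex)" for i :: 3
    by (cases "i = 0") simp_all
  then show ?thesis by (simp only: \<tau>_nth sum.delta finite UNIV_I if_True)
qed

lemma no_product_eigenbasis_\<tau>: "\<not> has_product_eigenbasis \<tau>"
proof
  assume "has_product_eigenbasis \<tau>"
  \<comment> \<open>\<open>block \<tau> 0 1\<close> is 1/6 times the matrix unit at (1, 0), which
    does not commute with its adjoint \<open>block \<tau> 1 0\<close>. In this position one product
    has 1/36, the other 0.\<close>
  then have "(block \<tau> 0 1 ** block \<tau> 1 0) $ 1 $ 1 = (block \<tau> 1 0 ** block \<tau> 0 1) $ 1 $ 1"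
    by (simp add: product_eigenbasis_blocks_commute)
  also have "\<dots> = 0"
    by (simp add: block_def matrix_matrix_mult_def \<tau>_nth_diag)
  finally have "(\<Sum>k\<in>UNIV. \<tau> $ (0, 1) $ (1, k) * \<tau> $ (1, k) $ (0, 1)) = 0"
    by (simp only: block_def matrix_matrix_mult_def vec_lambda_beta)
  moreover have "\<tau> $ (0, 1) $ (1, k) * \<tau> $ (1, k) $ (0, 1) = (if k = 0 then 1 / 6 * \<tau> $ (1, 0) $ (0, 1) else 0)" for k
    using distinct_3 by (simp add: \<tau>_nth_01)
  moreover have "\<tau> $ (1, 0) $ (0, 1) = cnj (\<tau> $ (0, 1) $ (1, 0))"
    using density_matrix_\<tau> unfolding density_matrix_def hermitian_def by blast
  ultimately show False by (simp add: \<tau>_nth_01)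
qed

lemma not_separable_\<tau>: "\<not> separable \<tau>"
proof
  assume "separable \<tau>"
  then have "\<tau> $ (0, 1) $ (1, 0) = 0"
    by (rule separable_zero_diag) (rule \<tau>_nth_diag)
  then show False by (simp add: \<tau>_nth_01)
qed

theorem mainTheorem10:
  "(density_matrix \<sigma> \<and> M \<sigma> = 0 \<and> \<not> has_product_eigenbasis \<sigma>) \<and>
   (density_matrix \<tau> \<and> M \<tau> = 0 \<and> \<not> has_product_eigenbasis \<tau> \<and> \<not> separable \<tau>)"
  by (intro conjI density_matrix_\<sigma> M_\<sigma> no_product_eigenbasis_\<sigma>
      density_matrix_\<tau> M_\<tau> no_product_eigenbasis_\<tau> not_separable_\<tau>)

end
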